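(* Let $X$ be a regular topological space and let $\mathscr{O}$ be the collection of all open covers of $X$. Then $X$ is star-Menger (that is, $X$ satisfies $\mathbf{S}^*_{fin}(\mathscr{O},\mathscr{O})$) if and only if $X$ satisfies the principle $\mathbf{CS}_{fin}(\mathscr{O},\mathscr{O})$.
   Context: Regular spaces are understood as in Engelking's "General Topology" (so $T_1$ is included). For a set $Y$, $[Y]^{<\omega}$ is the collection of all finite subsets of $Y$ (including $\emptyset$; $\bigcup\emptyset=\emptyset$). For $A\subseteq X$ and a family $\mathcal{U}$ of subsets of $X$, the star of $A$ with respect to $\mathcal{U}$ is $St(A,\mathcal{U})=\bigcup\{U\in\mathcal{U}:U\cap A\neq\emptyset\}$. Let $\mathscr{A},\mathscr{B}$ be collections of families of subsets of $X$. $\mathbf{S}^*_{fin}(\mathscr{A},\mathscr{B})$: for any sequence $\{\mathcal{A}_n:n\in\omega\}$ of elements of $\mathscr{A}$ there is a sequence $\{\mathcal{B}_n:n\in\omega\}$ such that $\mathcal{B}_n$ is a finite subset of $\mathcal{A}_n$ for each $n\in\omega$, and $\bigcup_{n\in\omega}\{St(B,\mathcal{A}_n):B\in\mathcal{B}_n\}\in\mathscr{B}$. $\mathbf{CS}_{fin}(\mathscr{A},\mathscr{B})$: for any sequence $\{\mathcal{U}_n:n\in\omega\}$ of elements of $\mathscr{A}$ there is a sequence $\{\mathcal{U}_n^f:n\in\omega\}$ such that, for each $n\in\omega$, $\mathcal{U}_n^f=\{U_n^1,\dots,U_n^{k_n}\}$ is a finite subset of $\mathcal{U}_n$, and $\bigcup\{\mathcal{V}_n^i:n\in\omega\text{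 and }i\in\{1,\dots,k_n\}\}\in\mathscr{B}$, where $\mathcal{V}_n^i=\{\bigcup\mathcal{V}:\mathcal{V}\in[\mathcal{U}_n]^{<\omega}\text{ and }U_n^i\cap V\neq\emptyset\text{ for each }V\in\mathcal{V}\}$. *)

theory Defs
  imports "HOL-Analysis.Analysis"
begin

definition open_covers :: "'a topology \<Rightarrow> 'a set set set" where
  "open_covers X = {\<U>. (\<forall>U\<in>\<U>. openin X U) \<and> \<Union>\<U> = topspace X}"

definition St :: "'a set \<Rightarrow> 'a set set \<Rightarrow> 'a set" where
  "St A \<U> = \<Union>{U \<in> \<U>. U \<inter> A \<noteq> {}}"

definition star_S_fin :: "'a set set set \<Rightarrow> 'a set set set \<Rightarrow> bool" where
  "star_S_fin \<A> \<B> \<longleftrightarrow>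
    (\<forall>A :: nat \<Rightarrow> 'a set set. (\<forall>n. A n \<in> \<A>) \<longrightarrow>
      (\<exists>B :: nat \<Rightarrow> 'a set set.
        (\<forall>n. finite (B n) \<and> B n \<subseteq> A n) \<and>
        (\<Union>n. {St b (A n) | b. b \<in> B n}) \<in> \<B>))"

(* For W = U_n^i this is the family V_n^i attached to the cover U_n.  The union over
   the empty subfamily is included, so the empty set is always a member. *)
definition touching_unions :: "'a set set \<Rightarrow> 'a set \<Rightarrow> 'a set set" where
  "touching_unions \<U> W =
    {\<Union>\<V> | \<V>. finite \<V> \<and> \<V> \<subseteq> \<U> \<and> (\<forall>V\<in>\<V>. W \<inter> V \<noteq> {})}"

(* The enumeration U_n^1, ..., U_n^{k_n} serves only to index V_n^i, which depends on
   the set U_n^i alone; the union is therefore taken over the members of F n.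
   As in star_S_fin, the finite subfamilies may be empty. *)
definition CS_fin :: "'a set set set \<Rightarrow> 'a set set set \<Rightarrow> bool" where
  "CS_fin \<A> \<B> \<longleftrightarrow>
    (\<forall>\<U> :: nat \<Rightarrow> 'a set set. (\<forall>n. \<U> n \<in> \<A>) \<longrightarrow>
      (\<exists>F :: nat \<Rightarrow> 'a set set.
        (\<forall>n. finite (F n) \<and> F n \<subseteq> \<U> n) \<and>
        (\<Union>n. \<Union>W\<in>F n. touching_unions (\<U> n) W) \<in> \<B>))"

definition star_Menger :: "'a topology \<Rightarrow> bool" where
  "star_Menger X \<longleftrightarrow> star_S_fin (open_covers X) (open_covers X)"

end

theory Submission
  imports Defs
begin

text \<open>
  For a family \<open>\<U>\<close> and a set \<open>W\<close>, the finite unions of members of \<open>\<U>\<close> that meet \<open>W\<close>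
  cover exactly the star \<open>St W \<U>\<close>: each such union lies in the star, and a single
  member meeting \<open>W\<close> is itself such a union. When \<open>\<U>\<close> is an open cover, the stars and
  the finite unions are moreover all open. Hence, for a fixed choice of finite subfamilies
  \<open>F n \<subseteq> \<U> n\<close>, the stars of their members form an open cover if and only if the
  finite unions do, and the two selection principles have the same witnesses.
\<close>

lemma Union_touching_unions: "\<Union>(touching_unions \<U> W) = St W \<U>"
proof
  show "\<Union>(touching_unions \<U> W) \<subseteq> St W \<U>"
    unfolding touching_unions_def St_def by blast
  show "St W \<U> \<subseteq> \<Union>(touching_unions \<U> W)"
  proof
    fix x assume "x \<in> St W \<U>"
    then obtain V where V: "V \<in> \<U>" "V \<inter> W \<noteq> {}" "x \<in> V"
      unfolding St_def by blast
    have "\<Union>{V} \<in> touching_unions \<U> W"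
      unfolding touching_unions_def using V by blast
    then show "x \<in> \<Union>(touching_unions \<U> W)"
      using V(3) by auto
  qed
qed

lemma openin_St:
  assumes "\<U> \<in> open_covers X"
  shows "openin X (St A \<U>)"
  using assms unfolding open_covers_def St_def by (intro openin_Union) auto

lemma openin_touching_unions:
  assumes "\<U> \<in> open_covers X" and "S \<in> touching_unions \<U> W"
  shows "openin X S"
proof -
  obtain \<V> where "S = \<Union>\<V>" "\<V> \<subseteq> \<U>"
    using assms(2) unfolding touching_unions_def by blast
  then show ?thesis
    using assms(1) unfolding open_covers_def by (auto intro!: openin_Union)
qed

lemma stars_open_cover_iff_touching_unions_open_cover:
  assumes "\<And>n. \<U> n \<in> open_covers X"
  shows "(\<Union>n. {St W (\<U> n) | W. W \<in> F n}) \<in> open_covers X \<longleftrightarrow>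
         (\<Union>n. \<Union>W\<in>F n. touching_unions (\<U> n) W) \<in> open_covers X"
    (is "?S \<in> _ \<longleftrightarrow> ?T \<in> _")
proof -
  have "\<Union>?T = (\<Union>n. \<Union>W\<in>F n. \<Union>(touching_unions (\<U> n) W))"
    by blast
  also have "\<dots> = \<Union>?S"
    unfolding Union_touching_unions by blast
  finally have "\<Union>?T = \<Union>?S" .
  moreover have "\<forall>S\<in>?S. openin X S"
    using openin_St[OF assms] by blast
  moreover have "\<forall>S\<in>?T. openin X S"
    using openin_touching_unions[OF assms] by blast
  ultimately show ?thesis
    unfolding open_covers_def by simp
qed

theorem theorem2p11:
  fixes X :: "'a topology"
  assumes "regular_space X" and "t1_space X"
  shows "star_Menger X \<longleftrightarrow> CS_fin (open_covers X) (open_covers X)"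
  unfolding star_Menger_def star_S_fin_def CS_fin_def
  by (simp add: stars_open_cover_iff_touching_unions_open_cover cong: imp_cong)

end
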